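(* Let $m\ge 1$ and let $\underline{r}=(r_1,\dots,r_m)$ be pairwise coprime integers $r_i\ge 2$. For $n\ge 0$ let $CP_{\underline{r},n}$ be the set of partitions of $n$ none of whose parts is divisible by any of $r_1,\dots,r_m$. For a partition $\rho$ write $\rho=(\rho_1,\dots,\rho_{\ell(\rho)})$ with $\ell(\rho)$ its number of parts and $m_i(\rho)$ the multiplicity of $i$ in $\rho$. Put $$a_{\underline{r},n}=\prod_{\rho\in CP_{\underline{r},n}}\prod_{i=1}^{\ell(\rho)}\rho_i,\qquad b_{\underline{r},n}=\prod_{\rho\in CP_{\underline{r},n}}\prod_{i\ge1} m_i(\rho)!,$$ and $W_{\underline{r},s,n}=\sum_{\rho\in CP_{\underline{r},n}}|\{i\ge1\mid m_i(\rho)\ge s\}|$ for $s\ge1$. For $1\le i\le m$ define $$c_{r_i,n}=\sum_{\substack{j\ge 1\\ r_l\nmid j \text{ for all } l}}\ \sum_{k_1,\dots,k_m\ge0} k_i\, W_{\underline{r},\,r_1^{k_1}\cdots r_m^{k_m}j,\,n}.$$ Then $$b_{\underline{r},n}=\prod_{i=1}^m r_i^{\,c_{r_i,n}}\; a_{\underline{r},n}.$$ *)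

theory Defs
  imports "HOL-Library.Multiset" "HOL-Library.FuncSet" "HOL-Analysis.Infinite_Sum"
begin

text \<open>
  A partition is the multiset of its parts.  A tuple \<open>(r\<^sub>1, \<dots>, r\<^sub>m)\<close> is a function on
  \<open>{1..m}\<close>.
\<close>

definition CP :: "nat \<Rightarrow> (nat \<Rightarrow> nat) \<Rightarrow> nat \<Rightarrow> nat multiset set" where
  "CP m r n = {\<rho>. (\<forall>p \<in># \<rho>. p \<ge> 1 \<and> (\<forall>l\<in>{1..m}. \<not> r l dvd p)) \<and> sum_mset \<rho> = n}"

definition part_prod :: "nat \<Rightarrow> (nat \<Rightarrow> nat) \<Rightarrow> nat \<Rightarrow> nat" where
  "part_prod m r n = (\<Prod>\<rho>\<in>CP m r n. prod_mset \<rho>)"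

text \<open>Factors with \<open>i \<notin># \<rho>\<close> are \<open>0! = 1\<close> and are left out.\<close>

definition mult_fact_prod :: "nat \<Rightarrow> (nat \<Rightarrow> nat) \<Rightarrow> nat \<Rightarrow> nat" where
  "mult_fact_prod m r n = (\<Prod>\<rho>\<in>CP m r n. \<Prod>i\<in>set_mset \<rho>. fact (count \<rho> i))"

definition W_count :: "nat \<Rightarrow> (nat \<Rightarrow> nat) \<Rightarrow> nat \<Rightarrow> nat \<Rightarrow> nat" where
  "W_count m r s n = (\<Sum>\<rho>\<in>CP m r n. card {i. i \<ge> 1 \<and> count \<rho> i \<ge> s})"

text \<open>
  The exponents \<open>(k\<^sub>1, \<dots>, k\<^sub>m)\<close> range over extensional functions, so each tuple is counted
  once.  The sums are finitely supported, hence summable (see the lemmas below).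
\<close>

definition c_exp :: "nat \<Rightarrow> (nat \<Rightarrow> nat) \<Rightarrow> nat \<Rightarrow> nat \<Rightarrow> nat" where
  "c_exp m r i n =
    (\<Sum>\<^sub>\<infinity>j\<in>{j. j \<ge> 1 \<and> (\<forall>l\<in>{1..m}. \<not> r l dvd j)}.
      \<Sum>\<^sub>\<infinity>k\<in>{1..m} \<rightarrow>\<^sub>E UNIV. k i * W_count m r ((\<Prod>l=1..m. r l ^ k l) * j) n)"

lemma size_le_sum_mset:
  fixes \<rho> :: "nat multiset"
  assumes "\<forall>p \<in># \<rho>. p \<ge> 1"
  shows "size \<rho> \<le> sum_mset \<rho>"
  using assms by (induction \<rho>) auto

lemma finite_CP: "finite (CP m r n)"
proof (rule finite_subset)
  show "CP m r n \<subseteq> mset ` {xs. set xs \<subseteq> {..n} \<and> length xs \<le> n}"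
  proof
    fix \<rho> assume "\<rho> \<in> CP m r n"
    then have pos: "\<forall>p \<in># \<rho>. p \<ge> 1" and sum: "sum_mset \<rho> = n"
      by (auto simp: CP_def)
    obtain xs where xs: "mset xs = \<rho>" using ex_mset by blast
    have "length xs \<le> n" using size_le_sum_mset[OF pos] sum xs by auto
    moreover have "p \<le> n" if p: "p \<in># \<rho>" for p
    proof -
      obtain \<sigma> where "\<rho> = add_mset p \<sigma>" using multi_member_split[OF p] by blast
      then show ?thesis using sum by simp
    qed
    ultimately show "\<rho> \<in> mset ` {xs. set xs \<subseteq> {..n} \<and> length xs \<le> n}"
      using xs by auto
  qed
qed (simp add: finite_lists_length_le)

lemma W_count_eq_0:
  assumes "s > n"
  shows "W_count m r s n = 0"
proof -
  have "card {i. i \<ge> 1 \<and> count \<rho> i \<ge> s} = 0" if "\<rho> \<in> CP m r n" for \<rho>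
  proof -
    have "size \<rho> \<le> n" using that size_le_sum_mset[of \<rho>] by (auto simp: CP_def)
    then have "count \<rho> i < s" for i
      using count_le_size[of \<rho> i] assms by linarith
    then have "{i. i \<ge> 1 \<and> count \<rho> i \<ge> s} = {}" by (auto simp: not_le)
    then show ?thesis by (simp only: card.empty)
  qed
  then show ?thesis by (simp add: W_count_def)
qed

lemma
  assumes r: "\<And>l. l \<in> {1..m} \<Longrightarrow> r l \<ge> 2" and j: "j \<ge> 1"
  shows c_exp_inner_summable:
      "(\<lambda>k. k i * W_count m r ((\<Prod>l=1..m. r l ^ k l) * j) n) summable_on ({1..m} \<rightarrow>\<^sub>E UNIV)"
    and W_count_eq_0_j: "j > n \<Longrightarrow> W_count m r ((\<Prod>l=1..m. r l ^ k l) * j) n = 0"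
proof -
  have pos: "(\<Prod>l\<in>A. r l ^ k l) \<ge> 1" if "A \<subseteq> {1..m}" for k A
  proof (rule prod_ge_1)
    fix l assume "l \<in> A"
    then have "r l \<ge> 2" using that by (intro r) blast
    then show "1 \<le> r l ^ k l" by (intro one_le_power) linarith
  qed
  show "W_count m r ((\<Prod>l=1..m. r l ^ k l) * j) n = 0" if "j > n"
  proof (rule W_count_eq_0)
    have "1 * j \<le> (\<Prod>l=1..m. r l ^ k l) * j"
      by (rule mult_le_mono1) (rule pos, simp)
    then show "n < (\<Prod>l=1..m. r l ^ k l) * j" using that by linarith
  qed
  have bound: "k l \<le> n" if "l \<in> {1..m}" "W_count m r ((\<Prod>l=1..m. r l ^ k l) * j) n \<noteq> 0" for k l
  proof -
    have "k l < 2 ^ k l" by simp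
    also have "\<dots> \<le> r l ^ k l" using r[OF that(1)] by (simp add: power_mono)
    also have "\<dots> \<le> r l ^ k l * (\<Prod>l\<in>{1..m} - {l}. r l ^ k l)"
      using mult_le_mono2[OF pos[of "{1..m} - {l}" k], of "r l ^ k l"] by simp
    also have "\<dots> = (\<Prod>l=1..m. r l ^ k l)"
      by (rule prod.remove[symmetric]) (use that(1) in simp_all)
    also have "\<dots> \<le> (\<Prod>l=1..m. r l ^ k l) * j" using j by simp
    also have "\<dots> \<le> n"
    proof (rule ccontr)
      assume "\<not> (\<Prod>l=1..m. r l ^ k l) * j \<le> n"
      then have "n < (\<Prod>l=1..m. r l ^ k l) * j" by (rule not_le_imp_less)
      then show False using that(2) W_count_eq_0 by metis
    qed
    finally show ?thesis by simp
  qed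
  have "finite {k \<in> {1..m} \<rightarrow>\<^sub>E UNIV. k i * W_count m r ((\<Prod>l=1..m. r l ^ k l) * j) n \<noteq> 0}"
  proof (rule finite_subset)
    show "finite ({1..m} \<rightarrow>\<^sub>E {..n})" by (rule finite_PiE) simp_all
    show "{k \<in> {1..m} \<rightarrow>\<^sub>E UNIV. k i * W_count m r ((\<Prod>l=1..m. r l ^ k l) * j) n \<noteq> 0}
      \<subseteq> {1..m} \<rightarrow>\<^sub>E {..n}"
    proof
      fix k
      assume k: "k \<in> {k \<in> {1..m} \<rightarrow>\<^sub>E UNIV. k i * W_count m r ((\<Prod>l=1..m. r l ^ k l) * j) n \<noteq> 0}"
      then have "W_count m r ((\<Prod>l=1..m. r l ^ k l) * j) n \<noteq> 0"
        by (intro notI) simp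
      then have "k l \<le> n" if "l \<in> {1..m}" for l
        by (rule bound[OF that])
      then show "k \<in> {1..m} \<rightarrow>\<^sub>E {..n}" using k unfolding PiE_iff by blast
    qed
  qed
  then show "(\<lambda>k. k i * W_count m r ((\<Prod>l=1..m. r l ^ k l) * j) n) summable_on ({1..m} \<rightarrow>\<^sub>E UNIV)"
    by (rule finite_nonzero_values_imp_summable_on)
qed

lemma c_exp_outer_summable:
  assumes "\<And>l. l \<in> {1..m} \<Longrightarrow> r l \<ge> 2"
  shows "(\<lambda>j. \<Sum>\<^sub>\<infinity>k\<in>{1..m} \<rightarrow>\<^sub>E UNIV. k i * W_count m r ((\<Prod>l=1..m. r l ^ k l) * j) n)
    summable_on {j. j \<ge> 1 \<and> (\<forall>l\<in>{1..m}. \<not> r l dvd j)}"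
proof (rule finite_nonzero_values_imp_summable_on, rule finite_subset)
  show "{j \<in> {j. j \<ge> 1 \<and> (\<forall>l\<in>{1..m}. \<not> r l dvd j)}.
      (\<Sum>\<^sub>\<infinity>k\<in>{1..m} \<rightarrow>\<^sub>E UNIV. k i * W_count m r ((\<Prod>l=1..m. r l ^ k l) * j) n) \<noteq> 0} \<subseteq> {..n}"
  proof (rule subsetI, rule ccontr)
    fix j
    assume j: "j \<in> {j \<in> {j. j \<ge> 1 \<and> (\<forall>l\<in>{1..m}. \<not> r l dvd j)}.
      (\<Sum>\<^sub>\<infinity>k\<in>{1..m} \<rightarrow>\<^sub>E UNIV. k i * W_count m r ((\<Prod>l=1..m. r l ^ k l) * j) n) \<noteq> 0}"
      and "j \<notin> {..n}"
    then have "j > n" "j \<ge> 1" by auto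
    then have "W_count m r ((\<Prod>l=1..m. r l ^ k l) * j) n = 0" for k
      by (intro W_count_eq_0_j assms)
    then show False using j by simp
  qed
qed simp

end

theory Submission
  imports Defs "HOL-Computational_Algebra.Factorial_Ring"
begin

text \<open>
  Call a positive integer free if no \<open>r\<^sub>l\<close> divides it, and let \<open>N x\<close> be the number of partitions
  in \<open>CP\<close> of \<open>n - x\<close>.  Removing \<open>s\<close> copies of a free part \<open>i\<close> shows that exactly \<open>N (s i)\<close> partitions
  of \<open>n\<close> contain \<open>i\<close> at least \<open>s\<close> times.  Hence, over all pairs \<open>(s, i)\<close> with \<open>i\<close> free and
  \<open>s i \<le> n\<close>, the product of the multiplicity factorials is \<open>\<Prod> s ^ N (s i)\<close> and the product of
  the parts is \<open>\<Prod> i ^ N (s i)\<close>.  By coprimality every \<open>s\<close> is uniquely \<open>r\<^sub>1^k\<^sub>1 \<cdots> r\<^sub>m^k\<^sub>m j\<close> with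
  \<open>j\<close> free.  The powers of the \<open>r\<^sub>l\<close> are collected by the exponents \<open>c\<close>, and what remains of the
  first product is \<open>\<Prod> j ^ N (s i)\<close>, which the involution exchanging \<open>i\<close> and \<open>j\<close> turns into the
  second product.
\<close>

section \<open>Auxiliary facts on coprime products and multisets\<close>

lemma prod_coprime_dvd:
  fixes x :: "'a::semiring_gcd"
  assumes "finite A"
    and "\<And>a. a \<in> A \<Longrightarrow> f a dvd x"
    and "\<And>a b. a \<in> A \<Longrightarrow> b \<in> A \<Longrightarrow> a \<noteq> b \<Longrightarrow> coprime (f a) (f b)"
  shows "prod f A dvd x"
  using assms
proof (induction A rule: finite_induct)
  case (insert a A)
  then have "coprime (f a) (prod f A)"
    by (intro prod_coprime_right) auto
  with insert show ?case by (simp add: divides_mult)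
qed simp

lemma replicate_mset_split:
  assumes "s \<le> count \<rho> i"
  shows "\<exists>\<sigma>. \<rho> = \<sigma> + replicate_mset s i"
  using assms by (metis count_le_replicate_mset_subset_eq subset_mset.diff_add)

section \<open>Factorisation into powers of the \<open>r l\<close> and a free part\<close>

locale coprime_tuple =
  fixes m :: nat and r :: "nat \<Rightarrow> nat"
  assumes r_ge_2: "l \<in> {1..m} \<Longrightarrow> r l \<ge> 2"
    and r_coprime: "i \<in> {1..m} \<Longrightarrow> l \<in> {1..m} \<Longrightarrow> i \<noteq> l \<Longrightarrow> coprime (r i) (r l)"
begin

definition free :: "nat set" where
  "free = {j. j \<ge> 1 \<and> (\<forall>l\<in>{1..m}. \<not> r l dvd j)}"

definition rpow :: "(nat \<Rightarrow> nat) \<Rightarrow> nat" where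
  "rpow k = (\<Prod>l=1..m. r l ^ k l)"

text \<open>The restriction to \<open>{1..m}\<close> places \<open>exps s\<close> in the extensional
  index set of the inner sum of \<open>c_exp\<close>. The \<open>r l\<close> need not be prime: for
  \<open>s > 0\<close> the entry at \<open>l\<close> is the largest \<open>e\<close> such that
  \<open>r l ^ e\<close> divides \<open>s\<close>.\<close>

definition exps :: "nat \<Rightarrow> nat \<Rightarrow> nat" where
  "exps s = (\<lambda>l\<in>{1..m}. multiplicity (r l) s)"

definition free_part :: "nat \<Rightarrow> nat" where
  "free_part s = s div rpow (exps s)"

definition pairs :: "nat \<Rightarrow> (nat \<times> nat) set" where
  "pairs n = (SIGMA s:{1..n}. {i \<in> free. s * i \<le> n})"

lemma rpow_pos: "rpow k > 0"
  unfolding rpow_def by (intro prod_pos) (use r_ge_2 in force)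

lemma exps_in_PiE: "exps s \<in> {1..m} \<rightarrow>\<^sub>E UNIV"
  by (simp add: exps_def)

lemma rpow_split:
  assumes "l \<in> {1..m}"
  shows "\<exists>q. rpow k = r l ^ k l * q \<and> coprime (r l) q"
proof (intro exI conjI)
  show "rpow k = r l ^ k l * (\<Prod>i\<in>{1..m} - {l}. r i ^ k i)"
    unfolding rpow_def by (rule prod.remove) (use assms in auto)
  show "coprime (r l) (\<Prod>i\<in>{1..m} - {l}. r i ^ k i)"
    by (intro prod_coprime_right coprime_power_right_iff[THEN iffD2] disjI1 r_coprime)
      (use assms in auto)
qed

lemma multiplicity_rpow_mult:
  assumes "l \<in> {1..m}" "j \<in> free"
  shows "multiplicity (r l) (rpow k * j) = k l"
proof (rule multiplicity_eqI)
  obtain q where q: "rpow k = r l ^ k l * q" "coprime (r l) q"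
    using rpow_split[OF assms(1)] by blast
  show "r l ^ k l dvd rpow k * j" by (simp add: q(1))
  show "\<not> r l ^ Suc (k l) dvd rpow k * j"
  proof
    assume "r l ^ Suc (k l) dvd rpow k * j"
    then have "r l ^ k l * r l dvd r l ^ k l * (q * j)"
      by (simp add: q(1) mult_ac)
    then have "r l dvd q * j"
      using r_ge_2[OF assms(1)] by simp
    then have "r l dvd j"
      using q(2) by (simp add: coprime_dvd_mult_right_iff)
    then show False using assms by (auto simp: free_def)
  qed
qed

text \<open>Together with \<open>free_part_rpow_mult\<close> this is the uniqueness of the
  factorisation; existence is \<open>rpow_mult_free_part\<close> with
  \<open>free_part_in_free\<close>.\<close>

lemma exps_rpow_mult:
  assumes "k \<in> {1..m} \<rightarrow>\<^sub>E UNIV" "j \<in> free"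
  shows "exps (rpow k * j) = k"
  by (rule PiE_ext[OF exps_in_PiE assms(1)])
    (simp add: exps_def multiplicity_rpow_mult assms(2))

lemma free_part_rpow_mult:
  assumes "k \<in> {1..m} \<rightarrow>\<^sub>E UNIV" "j \<in> free"
  shows "free_part (rpow k * j) = j"
  using rpow_pos[of k] by (simp add: free_part_def exps_rpow_mult[OF assms])

text \<open>Each maximal power of an \<open>r l\<close> divides \<open>s\<close>, and these powers
  are pairwise coprime.\<close>

lemma rpow_exps_dvd: "rpow (exps s) dvd s"
  unfolding rpow_def
  by (rule prod_coprime_dvd)
    (auto simp: exps_def multiplicity_dvd intro!: r_coprime)

lemma rpow_mult_free_part: "rpow (exps s) * free_part s = s"
  by (simp add: free_part_def rpow_exps_dvd)

text \<open>A factor \<open>r l\<close> of the free part could be joined to the power of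
  \<open>r l\<close> already split off, contradicting the maximality of that power.\<close>

lemma free_part_in_free:
  assumes "s \<ge> 1"
  shows "free_part s \<in> free"
proof -
  have "\<not> r l dvd free_part s" if l: "l \<in> {1..m}" for l
  proof
    assume "r l dvd free_part s"
    moreover obtain q where "rpow (exps s) = r l ^ exps s l * q"
      using rpow_split[OF l] by blast
    ultimately have "r l ^ Suc (exps s l) dvd s"
      using rpow_mult_free_part[of s]
      by (metis dvd_triv_left mult_dvd_mono power_Suc2)
    moreover have "\<not> r l ^ Suc (multiplicity (r l) s) dvd s"
      using r_ge_2[OF l] assms by (subst power_dvd_iff_le_multiplicity) auto
    ultimately show False using l by (simp add: exps_def)
  qed
  moreover have "free_part s \<ge> 1"
    using rpow_mult_free_part[of s] assms by (cases "free_part s") auto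
  ultimately show ?thesis by (simp add: free_def)
qed

section \<open>Pairs \<open>(s, i)\<close> and counting partitions by multiplicity\<close>

lemma finite_cofactors:
  assumes "s \<ge> 1"
  shows "finite {i \<in> free. s * i \<le> n}"
proof (rule finite_subset)
  show "{i \<in> free. s * i \<le> n} \<subseteq> {..n}"
  proof
    fix i assume i: "i \<in> {i \<in> free. s * i \<le> n}"
    have "i \<le> s * i" using assms by (cases s) auto
    also have "s * i \<le> n" using i by simp
    finally show "i \<in> {..n}" by simp
  qed
qed simp

lemma finite_pairs: "finite (pairs n)"
  unfolding pairs_def by (intro finite_SigmaI finite_cofactors) auto

lemma pairs_iff: "(s, i) \<in> pairs n \<longleftrightarrow> s \<ge> 1 \<and> i \<in> free \<and> s * i \<le> n"
proof -
  have "s \<le> n" if "i \<in> free" "s * i \<le> n"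
    using that by (cases i) (auto simp: free_def)
  then show ?thesis by (auto simp: pairs_def)
qed

lemma CP_iff: "\<rho> \<in> CP m r n \<longleftrightarrow> set_mset \<rho> \<subseteq> free \<and> sum_mset \<rho> = n"
  by (auto simp: CP_def free_def)

text \<open>Adding \<open>s\<close> copies of \<open>i\<close> is a bijection. The assumption
  \<open>s * i \<le> n\<close> makes the truncated subtraction \<open>n - s * i\<close>
  exact.\<close>

lemma card_count_ge:
  assumes "i \<in> free" "s * i \<le> n"
  shows "card {\<rho> \<in> CP m r n. s \<le> count \<rho> i} = card (CP m r (n - s * i))"
proof (rule bij_betw_same_card[symmetric])
  show "bij_betw (\<lambda>\<sigma>. \<sigma> + replicate_mset s i) (CP m r (n - s * i))
          {\<rho> \<in> CP m r n. s \<le> count \<rho> i}"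
    unfolding bij_betw_def
  proof
    show "inj_on (\<lambda>\<sigma>. \<sigma> + replicate_mset s i) (CP m r (n - s * i))"
      by (auto simp: inj_on_def)
    show "(\<lambda>\<sigma>. \<sigma> + replicate_mset s i) ` CP m r (n - s * i) = {\<rho> \<in> CP m r n. s \<le> count \<rho> i}"
    proof (intro equalityI subsetI)
      fix \<rho> assume \<rho>: "\<rho> \<in> {\<rho> \<in> CP m r n. s \<le> count \<rho> i}"
      then obtain \<sigma> where \<sigma>: "\<rho> = \<sigma> + replicate_mset s i"
        using replicate_mset_split[of s \<rho> i] by auto
      with \<rho> have "\<sigma> \<in> CP m r (n - s * i)" by (auto simp: CP_iff)
      with \<sigma> show "\<rho> \<in> (\<lambda>\<sigma>. \<sigma> + replicate_mset s i) ` CP m r (n - s * i)"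
        by (rule image_eqI)
    qed (use assms in \<open>auto simp: CP_iff split: if_splits\<close>)
  qed
qed

text \<open>The \<open>s\<close> copies of \<open>i\<close> contribute \<open>s * i\<close> to the
  total \<open>n\<close>, and as \<open>s \<ge> 1\<close>, \<open>i\<close> is a part and so is
  free.\<close>

lemma pairs_if_count_ge:
  assumes "\<rho> \<in> CP m r n" "1 \<le> s" "s \<le> count \<rho> i"
  shows "(s, i) \<in> pairs n"
proof -
  obtain \<sigma> where "\<rho> = \<sigma> + replicate_mset s i"
    using replicate_mset_split[OF assms(3)] by blast
  then show ?thesis using assms by (auto simp: pairs_iff CP_iff split: if_splits)
qed

text \<open>Double counting: \<open>f s i\<close> does not depend on \<open>\<rho>\<close>, so
  exchanging the products raises it to the number of partitions containing \<open>i\<close> at least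
  \<open>s\<close> times. The cases of interest are \<open>f s i = s\<close> and
  \<open>f s i = i\<close>.\<close>

lemma prod_over_counts:
  fixes f :: "nat \<Rightarrow> nat \<Rightarrow> nat"
  shows "(\<Prod>\<rho>\<in>CP m r n. \<Prod>i\<in>set_mset \<rho>. \<Prod>s=1..count \<rho> i. f s i)
    = (\<Prod>(s, i)\<in>pairs n. f s i ^ card (CP m r (n - s * i)))"
proof -
  have inner: "(\<Prod>i\<in>set_mset \<rho>. \<Prod>s=1..count \<rho> i. f s i)
      = (\<Prod>p\<in>{p \<in> pairs n. fst p \<le> count \<rho> (snd p)}. f (fst p) (snd p))" if "\<rho> \<in> CP m r n" for \<rho>
  proof -
    have "(\<Prod>i\<in>set_mset \<rho>. \<Prod>s=1..count \<rho> i. f s i)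
        = (\<Prod>(i, s)\<in>(SIGMA i:set_mset \<rho>. {1..count \<rho> i}). f s i)"
      by (rule prod.Sigma) auto
    also have "\<dots> = (\<Prod>p\<in>{p \<in> pairs n. fst p \<le> count \<rho> (snd p)}. f (fst p) (snd p))"
      \<comment> \<open>The product over parts yields pairs \<open>(i, s)\<close>, whereas
        \<open>pairs n\<close> lists \<open>s\<close> first.\<close>
      by (rule prod.reindex_bij_witness[of _ prod.swap prod.swap])
        (use that pairs_if_count_ge in \<open>auto simp: pairs_iff simp flip: count_greater_zero_iff\<close>)
    finally show ?thesis .
  qed
  have "(\<Prod>\<rho>\<in>CP m r n. \<Prod>i\<in>set_mset \<rho>. \<Prod>s=1..count \<rho> i. f s i)
      = (\<Prod>\<rho>\<in>CP m r n. \<Prod>p\<in>{p \<in> pairs n. fst p \<le> count \<rho> (snd p)}. f (fst p) (snd p))"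
    by (rule prod.cong[OF refl]) (rule inner)
  also have "\<dots> = (\<Prod>p\<in>pairs n. \<Prod>\<rho>\<in>{\<rho> \<in> CP m r n. fst p \<le> count \<rho> (snd p)}. f (fst p) (snd p))"
    by (rule prod.swap_restrict[OF finite_CP finite_pairs])
  also have "\<dots> = (\<Prod>(s, i)\<in>pairs n. f s i ^ card (CP m r (n - s * i)))"
    by (rule prod.cong) (auto simp: pairs_iff card_count_ge)
  finally show ?thesis .
qed

lemma mult_fact_prod_eq:
  "mult_fact_prod m r n = (\<Prod>(s, i)\<in>pairs n. s ^ card (CP m r (n - s * i)))"
  unfolding mult_fact_prod_def fact_prod of_nat_id by (rule prod_over_counts)

lemma part_prod_eq:
  "part_prod m r n = (\<Prod>(s, i)\<in>pairs n. i ^ card (CP m r (n - s * i)))"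
  \<comment> \<open>With \<open>f s i = i\<close> the innermost product is constant in
    \<open>s\<close> and equals \<open>i ^ count \<rho> i\<close>.\<close>
  unfolding part_prod_def prod_over_counts[symmetric]
  by (simp add: prod_mset_multiplicity)

text \<open>The additive form of the same double counting, for one fixed \<open>s\<close>.\<close>

lemma W_count_eq:
  assumes "s \<in> {1..n}"
  shows "W_count m r s n = (\<Sum>i\<in>{i \<in> free. s * i \<le> n}. card (CP m r (n - s * i)))"
proof -
  let ?I = "{i \<in> free. s * i \<le> n}"
  have fin: "finite ?I"
    using assms by (intro finite_cofactors) simp
  have "W_count m r s n = (\<Sum>\<rho>\<in>CP m r n. \<Sum>i\<in>{i \<in> ?I. s \<le> count \<rho> i}. 1)"
    unfolding W_count_def
  proof (rule sum.cong[OF refl])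
    fix \<rho> assume "\<rho> \<in> CP m r n"
    then have "{i. 1 \<le> i \<and> s \<le> count \<rho> i} = {i \<in> ?I. s \<le> count \<rho> i}"
      using pairs_if_count_ge[of \<rho> n s] assms by (auto simp: pairs_iff) (auto simp: free_def)
    then show "card {i. 1 \<le> i \<and> s \<le> count \<rho> i} = (\<Sum>i\<in>{i \<in> ?I. s \<le> count \<rho> i}. 1)"
      by simp
  qed
  also have "\<dots> = (\<Sum>i\<in>?I. \<Sum>\<rho>\<in>{\<rho> \<in> CP m r n. s \<le> count \<rho> i}. 1)"
    by (rule sum.swap_restrict[OF finite_CP fin])
  also have "\<dots> = (\<Sum>i\<in>?I. card (CP m r (n - s * i)))"
    by (rule sum.cong) (auto simp: card_count_ge)
  finally show ?thesis .
qed

section \<open>The exponents \<open>c_exp\<close> as finite sums\<close>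

text \<open>These bounds confine the nonzero terms of \<open>c_exp\<close> to a finite box, because
  \<open>W_count\<close> vanishes beyond \<open>n\<close>. The bound on \<open>k l\<close> comes
  from \<open>k l < 2 ^ k l\<close>.\<close>

lemma rpow_mult_le_bounds:
  assumes "rpow k * j \<le> n" "j \<ge> 1"
  shows "j \<le> n" and "l \<in> {1..m} \<Longrightarrow> k l \<le> n"
proof -
  have "j \<le> rpow k * j"
    using rpow_pos[of k] by (cases "rpow k") auto
  then show "j \<le> n" using assms(1) by (rule order_trans)
  assume l: "l \<in> {1..m}"
  have "k l < 2 ^ k l" by simp
  also have "\<dots> \<le> r l ^ k l" using r_ge_2[OF l] by (simp add: power_mono)
  also have "\<dots> \<le> rpow k"
    using rpow_split[OF l, of k] rpow_pos[of k] by (metis dvd_imp_le dvd_triv_left)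
  also have "\<dots> \<le> rpow k * j" using assms by simp
  finally show "k l \<le> n" using assms by simp
qed

text \<open>After truncation to a finite box, the unique factorisation \<open>s = rpow k * j\<close>
  merges the double sum over \<open>j\<close> and \<open>k\<close> into a single sum over
  \<open>s\<close>.\<close>

lemma c_exp_eq:
  assumes "l \<in> {1..m}"
  shows "c_exp m r l n = (\<Sum>s=1..n. exps s l * W_count m r s n)"
proof -
  let ?K = "{1..m} \<rightarrow>\<^sub>E {..n}" and ?F = "free \<inter> {..n}"
  let ?h = "\<lambda>j k. k l * W_count m r (rpow k * j) n"
  have zero: "?h j k = 0" if "rpow k * j > n" for j k
    using W_count_eq_0[OF that] by simp
  have inner: "(\<Sum>\<^sub>\<infinity>k\<in>{1..m} \<rightarrow>\<^sub>E UNIV. ?h j k) = (\<Sum>k\<in>?K. ?h j k)" if "j \<in> free" for j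
  proof -
    have "(\<Sum>\<^sub>\<infinity>k\<in>{1..m} \<rightarrow>\<^sub>E UNIV. ?h j k) = (\<Sum>\<^sub>\<infinity>k\<in>?K. ?h j k)"
    proof (rule infsum_cong_neutral)
      fix k assume k: "k \<in> ({1..m} \<rightarrow>\<^sub>E UNIV) - ?K"
      then have "\<not> rpow k * j \<le> n"
        using rpow_mult_le_bounds(2)[of k j n] that unfolding PiE_iff free_def by auto
      then show "?h j k = 0" by (intro zero) simp
    qed auto
    also have "\<dots> = (\<Sum>k\<in>?K. ?h j k)"
      by (intro infsum_finite finite_PiE) auto
    finally show ?thesis .
  qed
  have "c_exp m r l n = (\<Sum>\<^sub>\<infinity>j\<in>free. \<Sum>k\<in>?K. ?h j k)"
    unfolding c_exp_def free_def[symmetric] rpow_def[symmetric]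
    by (rule infsum_cong) (rule inner)
  also have "\<dots> = (\<Sum>\<^sub>\<infinity>j\<in>?F. \<Sum>k\<in>?K. ?h j k)"
  proof (rule infsum_cong_neutral)
    fix j assume j: "j \<in> free - ?F"
    have "?h j k = 0" for k
      by (rule zero, rule ccontr)
        (use rpow_mult_le_bounds(1)[of k j n] j in \<open>auto simp: free_def not_less\<close>)
    then show "(\<Sum>k\<in>?K. ?h j k) = 0" by (intro sum.neutral ballI)
  qed auto
  also have "\<dots> = (\<Sum>j\<in>?F. \<Sum>k\<in>?K. ?h j k)"
    by (rule infsum_finite) simp
  also have "\<dots> = (\<Sum>(j, k)\<in>?F \<times> ?K. ?h j k)"
    by (rule sum.cartesian_product)
  also have "\<dots> = (\<Sum>s=1..n. exps s l * W_count m r s n)"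
  \<comment> \<open>The box \<open>?F \<times> ?K\<close> also contains pairs with
    \<open>rpow k * j > n\<close>. They form the exceptional set \<open>S'\<close>, on which the
    summand is zero.\<close>
  proof (rule sum.reindex_bij_witness_not_neutral[where
        S' = "{p \<in> ?F \<times> ?K. rpow (snd p) * fst p > n}" and T' = "{}" and
        i = "\<lambda>s. (free_part s, exps s)" and j = "\<lambda>(j, k). rpow k * j"])
    have "finite (?F \<times> ?K)" by (intro finite_cartesian_product finite_PiE) auto
    then show "finite {p \<in> ?F \<times> ?K. rpow (snd p) * fst p > n}"
      by (rule rev_finite_subset) blast
  next
    fix p assume "p \<in> ?F \<times> ?K - {p \<in> ?F \<times> ?K. rpow (snd p) * fst p > n}"
    then obtain j k where p: "p = (j, k)" "j \<in> free" "k \<in> {1..m} \<rightarrow>\<^sub>E UNIV" "rpow k * j \<le> n"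
      by (cases p) (auto simp: PiE_iff)
    show "(free_part (case p of (j, k) \<Rightarrow> rpow k * j), exps (case p of (j, k) \<Rightarrow> rpow k * j)) = p"
      using p by (simp add: free_part_rpow_mult exps_rpow_mult)
    show "(case p of (j, k) \<Rightarrow> rpow k * j) \<in> {1..n} - {}"
      using p rpow_pos[of k] by (auto simp: free_def Suc_le_eq)
  next
    fix s assume s: "s \<in> {1..n} - {}"
    show "(case (free_part s, exps s) of (j, k) \<Rightarrow> rpow k * j) = s"
      by (simp add: rpow_mult_free_part)
    have free: "free_part s \<in> free" using s by (intro free_part_in_free) simp
    have "rpow (exps s) * free_part s \<le> n" "free_part s \<ge> 1"
      using s free by (auto simp: rpow_mult_free_part free_def)
    note bounds = rpow_mult_le_bounds[OF this]
    have "exps s \<in> ?K" using exps_in_PiE[of s] bounds(2) unfolding PiE_iff by auto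
    then show "(free_part s, exps s) \<in> ?F \<times> ?K - {p \<in> ?F \<times> ?K. rpow (snd p) * fst p > n}"
      using free bounds(1) s by (auto simp: rpow_mult_free_part)
  next
    fix p assume "p \<in> ?F \<times> ?K"
    then obtain j k where "p = (j, k)" "j \<in> free" "k \<in> {1..m} \<rightarrow>\<^sub>E UNIV"
      by (cases p) (auto simp: PiE_iff)
    then show "exps (case p of (j, k) \<Rightarrow> rpow k * j) l
        * W_count m r (case p of (j, k) \<Rightarrow> rpow k * j) n = (case p of (j, k) \<Rightarrow> ?h j k)"
      by (simp add: exps_rpow_mult)
  next
    fix p assume "p \<in> {p \<in> ?F \<times> ?K. rpow (snd p) * fst p > n}"
    then show "(case p of (j, k) \<Rightarrow> ?h j k) = 0"
      unfolding case_prod_beta by (intro zero) simp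
  qed simp_all
  finally show ?thesis .
qed

lemma c_exp_eq_sum_pairs:
  assumes "l \<in> {1..m}"
  shows "c_exp m r l n = (\<Sum>(s, i)\<in>pairs n. exps s l * card (CP m r (n - s * i)))"
proof -
  have "c_exp m r l n
      = (\<Sum>s=1..n. \<Sum>i\<in>{i \<in> free. s * i \<le> n}. exps s l * card (CP m r (n - s * i)))"
    by (simp add: c_exp_eq[OF assms] W_count_eq sum_distrib_left)
  also have "\<dots> = (\<Sum>(s, i)\<in>pairs n. exps s l * card (CP m r (n - s * i)))"
    unfolding pairs_def by (rule sum.Sigma) (auto intro: finite_cofactors)
  finally show ?thesis .
qed

section \<open>The exchange involution and the final identity\<close>

lemma prod_free_part_eq_part_prod:
  "(\<Prod>(s, i)\<in>pairs n. free_part s ^ card (CP m r (n - s * i))) = part_prod m r n"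
proof -
  \<comment> \<open>For \<open>s = rpow k * j\<close> the pair \<open>(rpow k * j, i)\<close> goes
    to \<open>(rpow k * i, j)\<close>: the free numbers trade places while \<open>rpow k\<close>
    stays in the first component. The product of the two components, and with it the exponent, is
    unchanged.\<close>
  define swap where "swap = (\<lambda>(s, i). (rpow (exps s) * i, free_part s))"
  have swap: "swap p \<in> pairs n" "swap (swap p) = p" "fst (swap p) * snd (swap p) = fst p * snd p"
    if p: "p \<in> pairs n" for p
  proof -
    obtain s i where si: "p = (s, i)" "s \<ge> 1" "i \<in> free" "s * i \<le> n"
      using p by (cases p) (auto simp: pairs_iff)
    have eq: "rpow (exps s) * i * free_part s = s * i"
      using rpow_mult_free_part[of s] by (metis mult.assoc mult.commute)
    then show "fst (swap p) * snd (swap p) = fst p * snd p"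
      by (simp add: si swap_def)
    show "swap p \<in> pairs n"
      using si rpow_pos[of "exps s"] free_part_in_free[of s]
      unfolding si(1) swap_def prod.case pairs_iff eq by (auto simp: free_def Suc_le_eq)
    show "swap (swap p) = p"
      using si exps_in_PiE[of s]
      by (simp add: swap_def exps_rpow_mult free_part_rpow_mult rpow_mult_free_part)
  qed
  show ?thesis
    unfolding part_prod_eq case_prod_beta
  proof (rule prod.reindex_bij_witness[of _ swap swap])
    fix p assume p: "p \<in> pairs n"
    have "snd (swap p) = free_part (fst p)"
      by (simp add: swap_def case_prod_beta)
    then show "snd (swap p) ^ card (CP m r (n - fst (swap p) * snd (swap p)))
        = free_part (fst p) ^ card (CP m r (n - fst p * snd p))"
      unfolding swap(3)[OF p] by simp
  qed (use swap in auto)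
qed

lemma mult_fact_prod_eq_c_exp:
  "mult_fact_prod m r n = (\<Prod>l=1..m. r l ^ c_exp m r l n) * part_prod m r n"
proof -
  let ?N = "\<lambda>s i. card (CP m r (n - s * i))"
  have "mult_fact_prod m r n = (\<Prod>(s, i)\<in>pairs n. (rpow (exps s) * free_part s) ^ ?N s i)"
    by (simp add: mult_fact_prod_eq rpow_mult_free_part)
  also have "\<dots> = (\<Prod>(s, i)\<in>pairs n. rpow (exps s) ^ ?N s i) * part_prod m r n"
    by (simp add: power_mult_distrib prod.distrib case_prod_beta
        flip: prod_free_part_eq_part_prod)
  also have "(\<Prod>(s, i)\<in>pairs n. rpow (exps s) ^ ?N s i)
      = (\<Prod>(s, i)\<in>pairs n. \<Prod>l=1..m. r l ^ (exps s l * ?N s i))"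
    by (simp add: rpow_def prod_power_distrib power_mult)
  \<comment> \<open>With \<open>l\<close> outermost, the exponents of each \<open>r l\<close> add up
    over all pairs to \<open>c_exp m r l n\<close>.\<close>
  also have "\<dots> = (\<Prod>l=1..m. \<Prod>(s, i)\<in>pairs n. r l ^ (exps s l * ?N s i))"
    unfolding case_prod_beta by (rule prod.swap)
  also have "\<dots> = (\<Prod>l=1..m. r l ^ c_exp m r l n)"
    by (rule prod.cong) (simp_all add: c_exp_eq_sum_pairs power_sum case_prod_beta)
  finally show ?thesis .
qed

end

theorem theorem2p3:
  fixes m n :: nat and r :: "nat \<Rightarrow> nat"
  assumes "m \<ge> 1"
    and "\<And>i. i \<in> {1..m} \<Longrightarrow> r i \<ge> 2"
    and "\<And>i l. i \<in> {1..m} \<Longrightarrow> l \<in> {1..m} \<Longrightarrow> i \<noteq> l \<Longrightarrow> coprime (r i) (r l)"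
  shows "mult_fact_prod m r n = (\<Prod>i=1..m. r i ^ c_exp m r i n) * part_prod m r n"
proof -
  interpret coprime_tuple m r
    using assms(2,3) by unfold_locales
  show ?thesis by (rule mult_fact_prod_eq_c_exp)
qed

end
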